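(* Let $m,n\ge 1$ and let $K_{m,n}$ be the complete bipartite graph with parts $\{1,\dots,m\}$ and $\{m+1,\dots,m+n\}$. For $1\le k\le m$, let $\mathfrak{T}^k_{m+n}$ be the set of spanning trees of $K_{m,n}$, rooted at $m+n$, which are uprooted (the root $m+n$ is larger than all of its children, automatically true here) and in which the highest (largest) child of the root $m+n$ equals $m+1-k$. Then \[|\mathfrak{T}^k_{m+n}| = m^{n-2}\, n^{m-k-1}\,(n-1)^{k-1}\,(m+n-k).\]
   Context: A rooted tree is oriented away from its root; the children of the root are its neighbours in the tree. An uprooted tree is a rooted tree whose root is greater than all of its children. *)

theory Defs
  imports Complex_Main
begin

text \<open>
  A graph is given by a vertex set and a set of edges, each edge being a two-element set of
  vertices. The symmetric digraphs of the AFP entry \<open>Graph_Theory\<close> are not used: there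
  \<open>a, b, a\<close> is a cycle, so that no symmetric digraph with an edge is a tree.
\<close>

definition simple_graph :: "'a set \<Rightarrow> 'a set set \<Rightarrow> bool" where
  "simple_graph V E \<longleftrightarrow> finite V \<and> (\<forall>e\<in>E. \<exists>u\<in>V. \<exists>v\<in>V. u \<noteq> v \<and> e = {u, v})"

definition neighbours :: "'a set set \<Rightarrow> 'a \<Rightarrow> 'a set" where
  "neighbours E v = {u. {u, v} \<in> E}"

definition connected_graph :: "'a set \<Rightarrow> 'a set set \<Rightarrow> bool" where
  "connected_graph V E \<longleftrightarrow> V \<noteq> {} \<and> (\<forall>u\<in>V. \<forall>v\<in>V. (u, v) \<in> {(x, y). {x, y} \<in> E}\<^sup>*)"

definition is_cycle :: "'a set set \<Rightarrow> 'a list \<Rightarrow> bool" where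
  "is_cycle E c \<longleftrightarrow> 3 \<le> length c \<and> distinct c \<and>
     (\<forall>i<length c. {c ! i, c ! (Suc i mod length c)} \<in> E)"

definition is_tree :: "'a set \<Rightarrow> 'a set set \<Rightarrow> bool" where
  "is_tree V E \<longleftrightarrow> simple_graph V E \<and> connected_graph V E \<and> (\<nexists>c. is_cycle E c)"

definition is_spanning_tree :: "'a set \<Rightarrow> 'a set set \<Rightarrow> 'a set set \<Rightarrow> bool" where
  "is_spanning_tree V E T \<longleftrightarrow> T \<subseteq> E \<and> is_tree V T"

definition rooted_tree :: "'a set \<Rightarrow> 'a set set \<Rightarrow> 'a \<Rightarrow> bool" where
  "rooted_tree V T r \<longleftrightarrow> is_tree V T \<and> r \<in> V"

text \<open>
  All edges of a rooted tree point away from the root, so every neighbour of the root is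
  a child of it. (At other vertices the parent would have to be left out.)
\<close>

definition root_children :: "'a set set \<Rightarrow> 'a \<Rightarrow> 'a set" where
  "root_children T r = neighbours T r"

definition uprooted_tree :: "'a::linorder set \<Rightarrow> 'a set set \<Rightarrow> 'a \<Rightarrow> bool" where
  "uprooted_tree V T r \<longleftrightarrow> rooted_tree V T r \<and> (\<forall>c\<in>root_children T r. c < r)"

definition Kmn_verts :: "nat \<Rightarrow> nat \<Rightarrow> nat set" where
  "Kmn_verts m n = {1..m} \<union> {m+1..m+n}"

definition Kmn_edges :: "nat \<Rightarrow> nat \<Rightarrow> nat set set" where
  "Kmn_edges m n = {{u, v} | u v. u \<in> {1..m} \<and> v \<in> {m+1..m+n}}"

text \<open>
  The vertex set and the root are the same for all trees in question, hence a rooted tree is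
  represented by its edge set. As \<open>m, n \<ge> 1\<close> and the tree is connected, the root
  has a child, so \<open>Max\<close> is applied to a non-empty finite set.
\<close>

definition uprooted_spanning_trees :: "nat \<Rightarrow> nat \<Rightarrow> nat \<Rightarrow> nat set set set" where
  "uprooted_spanning_trees m n k =
     {T. is_spanning_tree (Kmn_verts m n) (Kmn_edges m n) T \<and>
         uprooted_tree (Kmn_verts m n) T (m + n) \<and>
         Max (root_children T (m + n)) = m + 1 - k}"

end

theory Submission
  imports Defs "HOL-Library.FuncSet"
begin

text \<open>
  A tree rooted at \<open>r\<close> is the same as a map sending every other vertex to its parent such that
  iteration always leads to \<open>r\<close>. For a bipartite forest with root set \<open>I\<close>, let \<open>J\<close> be the set of
  children of roots: removing the roots leaves a bipartite forest with root set \<open>J\<close> and the roles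
  of the two sides exchanged, and each element of \<open>J\<close> had \<open>card I\<close> possible parents. By the
  binomial theorem the resulting recursion is solved by
  \<open>card I * (card I + card Q) ^ (card P - 1) * card P ^ card Q\<close>. For the root \<open>m + n\<close> of
  a spanning tree of \<open>K\<^bsub>m,n\<^esub>\<close>, the set \<open>J\<close> consists of \<open>m + 1 - k\<close> and an arbitrary subset of
  \<open>{1..m - k}\<close>; summing over these subsets gives the claim.
\<close>

section \<open>Parent maps and spanning trees\<close>

text \<open>Being a least fixed point, this holds exactly when some iterate of \<open>p\<close> from
  \<open>x\<close> meets \<open>I\<close>. Orbits that cycle outside \<open>I\<close> are excluded,
  which encodes acyclicity.\<close>

inductive reach :: "('a \<Rightarrow> 'a) \<Rightarrow> 'a set \<Rightarrow> 'a \<Rightarrow> bool" for p I where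
  base: "x \<in> I \<Longrightarrow> reach p I x"
| step: "reach p I (p x) \<Longrightarrow> reach p I x"

lemma not_reach_empty: "\<not> reach p {} x"
proof
  assume "reach p {} x"
  then show False by induction auto
qed

text \<open>An orbit starting in \<open>D\<close> stays there until it meets \<open>I\<close>, so
  only the values on \<open>D\<close> matter. This is what permits restricting and gluing parent
  maps.\<close>

lemma reach_cong:
  assumes "reach p I x" and "x \<in> D \<union> I"
    and "\<And>y. y \<in> D \<Longrightarrow> p y \<in> D \<union> I" and "\<And>y. y \<in> D \<Longrightarrow> q y = p y"
  shows "reach q I x"
  using assms(1,2)
proof (induction)
  case (base x)
  then show ?case by (simp add: reach.base)
next
  case (step x)
  show ?case
  proof (cases "x \<in> I")
    case True
    then show ?thesis by (rule reach.base)
  next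
    case False
    then have "x \<in> D" using step.prems by blast
    then have "reach q I (q x)" using step.IH assms(3,4) by simp
    then show ?thesis by (rule reach.step)
  qed
qed

text \<open>The depth is the least number of iterations leading to \<open>r\<close>; it serves as
  the measure for excluding cycles and for injectivity.\<close>

lemma ex_depth:
  assumes "r \<notin> D" and "\<And>x. x \<in> D \<Longrightarrow> reach p {r} x"
  obtains d :: "'a \<Rightarrow> nat" where "d r = 0" and "\<And>x. x \<in> D \<Longrightarrow> d x = Suc (d (p x))"
proof -
  define d where "d x = (LEAST k. (p ^^ k) x = r)" for x
  have "d r = 0" unfolding d_def by (rule Least_eq_0) simp
  moreover have "d x = Suc (d (p x))" if "x \<in> D" for x
  proof -
    have "reach p {r} x" using assms(2) that .
    then have "\<exists>k. (p ^^ k) x = r"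
    proof induction
      case (base x)
      then have "(p ^^ 0) x = r" by simp
      then show ?case by blast
    next
      case (step x)
      then obtain k where "(p ^^ k) (p x) = r" by blast
      then have "(p ^^ Suc k) x = r" by (simp add: funpow_swap1)
      then show ?case by blast
    qed
    then obtain k where k: "(p ^^ k) x = r" by blast
    have "x \<noteq> r" using assms(1) that by blast
    then have "\<not> (p ^^ 0) x = r" by simp
    \<comment> \<open>As \<open>x\<close> is not \<open>r\<close>, the least exponent is positive,
      and passing to \<open>p x\<close> lowers it by one.\<close>
    from Least_Suc[of "\<lambda>k. (p ^^ k) x = r", OF k this]
    show ?thesis unfolding d_def by (simp add: funpow_swap1)
  qed
  ultimately show ?thesis by (rule that)
qed

text \<open>Extensionality fixes the values at the root and outside \<open>V\<close>, so that each
  rooted tree corresponds to exactly one map.\<close>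

definition parent_maps :: "'a set \<Rightarrow> 'a set set \<Rightarrow> 'a \<Rightarrow> ('a \<Rightarrow> 'a) set" where
  "parent_maps V G r = {p \<in> extensional (V - {r}).
     \<forall>x\<in>V - {r}. p x \<in> V \<and> {x, p x} \<in> G \<and> reach p {r} x}"

definition parent_edges :: "'a set \<Rightarrow> 'a \<Rightarrow> ('a \<Rightarrow> 'a) \<Rightarrow> 'a set set" where
  "parent_edges V r p = (\<lambda>x. {x, p x}) ` (V - {r})"

lemma parent_maps_depth:
  assumes "p \<in> parent_maps V G r"
  obtains d :: "'a \<Rightarrow> nat" where "d r = 0" and "\<And>x. x \<in> V - {r} \<Longrightarrow> d x = Suc (d (p x))"
proof (rule ex_depth[of r "V - {r}" p])
  show "reach p {r} x" if "x \<in> V - {r}" for x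
    using assms that by (simp add: parent_maps_def)
qed (use that in auto)

lemma parent_edges_iff:
  "{x, y} \<in> parent_edges V r p \<longleftrightarrow> (x \<in> V - {r} \<and> y = p x) \<or> (y \<in> V - {r} \<and> x = p y)"
  by (auto simp: parent_edges_def doubleton_eq_iff)

text \<open>Following parents joins every vertex to \<open>r\<close>; by symmetry, any two vertices
  are joined through \<open>r\<close>.\<close>

lemma connected_parent_edges:
  assumes "r \<in> V" and "\<And>x. x \<in> V - {r} \<Longrightarrow> p x \<in> V \<and> reach p {r} x"
  shows "connected_graph V (parent_edges V r p)"
proof -
  define R where "R = {(x, y). {x, y} \<in> parent_edges V r p}"
  have "sym R" by (auto simp: R_def sym_def insert_commute)
  then have "sym (R\<^sup>*)" by (rule sym_rtrancl)
  have to_root: "(x, r) \<in> R\<^sup>*" if "reach p {r} x" "x \<in> V" for x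
    using that
  proof induction
    case (base x)
    then show ?case by simp
  next
    case (step x)
    show ?case
    proof (cases "x = r")
      case False
      then have "x \<in> V - {r}" using step.prems by blast
      then have "(x, p x) \<in> R" "p x \<in> V"
        using assms(2) by (auto simp: R_def parent_edges_iff)
      then show ?thesis using step.IH by (meson converse_rtrancl_into_rtrancl)
    qed simp
  qed
  have all: "(x, r) \<in> R\<^sup>*" if "x \<in> V" for x
  proof (cases "x = r")
    case False
    then show ?thesis using to_root assms(2) that by blast
  qed simp
  have "(u, v) \<in> R\<^sup>*" if "u \<in> V" "v \<in> V" for u v
    using all[OF that(1)] symD[OF \<open>sym (R\<^sup>*)\<close> all[OF that(2)]] by (rule rtrancl_trans)
  then show ?thesis using assms(1) by (auto simp: connected_graph_def R_def)
qed

text \<open>A vertex of maximal depth on a cycle would have its parent as both of its neighbours.\<close>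

lemma acyclic_parent_edges:
  assumes "d r = (0::nat)" and "\<And>x. x \<in> V - {r} \<Longrightarrow> d x = Suc (d (p x))"
  shows "\<not> is_cycle (parent_edges V r p) c"
proof
  assume c: "is_cycle (parent_edges V r p) c"
  define L where "L = length c"
  have L: "3 \<le> L" and dist: "distinct c"
    and edge: "\<And>i. i < L \<Longrightarrow> {c ! i, c ! (Suc i mod L)} \<in> parent_edges V r p"
    using c by (auto simp: is_cycle_def L_def)
  have "finite (d ` set c)" "d ` set c \<noteq> {}" using L by (auto simp: L_def)
  then have "Max (d ` set c) \<in> d ` set c" by (rule Max_in)
  then obtain x where "x \<in> set c" and x: "d x = Max (d ` set c)" by auto
  then obtain i where i: "i < L" "x = c ! i" by (auto simp: in_set_conv_nth L_def)
  have up: "y = p x" if "{x, y} \<in> parent_edges V r p" "y \<in> set c" for y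
  proof -
    have "d y \<le> d x" unfolding x using that(2) by simp
    then show ?thesis using that(1) assms(2)[of y] by (auto simp: parent_edges_iff)
  qed
  \<comment> \<open>\<open>j\<close> and \<open>k\<close> are the cyclic predecessor and successor
    of \<open>i\<close>; they differ because the cycle has length at least 3.\<close>
  define j where "j = (if i = 0 then L - 1 else i - 1)"
  define k where "k = Suc i mod L"
  have jk: "j < L" "k < L" "Suc j mod L = i" "j \<noteq> k"
    using i(1) L by (auto simp: j_def k_def mod_Suc)
  have "c ! k = p x"
    using edge[OF i(1)] jk by (intro up) (auto simp: i k_def L_def)
  moreover have "c ! j = p x"
    using edge[OF jk(1)] jk by (intro up) (auto simp: i L_def insert_commute)
  ultimately show False
    using jk(1,2,4) dist nth_eq_iff_index_eq[of c k j] by (simp add: L_def)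
qed

lemma parent_edges_spanning_tree:
  assumes "simple_graph V G" and "r \<in> V" and p: "p \<in> parent_maps V G r"
  shows "is_spanning_tree V G (parent_edges V r p)"
proof -
  obtain d :: "'a \<Rightarrow> nat" where d: "d r = 0" "\<And>x. x \<in> V - {r} \<Longrightarrow> d x = Suc (d (p x))"
    by (rule parent_maps_depth[OF p]) blast
  have sub: "parent_edges V r p \<subseteq> G"
    using p by (auto simp: parent_edges_def parent_maps_def)
  then have "simple_graph V (parent_edges V r p)"
    using assms(1) unfolding simple_graph_def by blast
  moreover have "connected_graph V (parent_edges V r p)"
    using p assms(2) by (intro connected_parent_edges) (auto simp: parent_maps_def)
  moreover have "\<not> is_cycle (parent_edges V r p) c" for c
    using d by (rule acyclic_parent_edges)
  ultimately show ?thesis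
    using sub by (simp add: is_spanning_tree_def is_tree_def)
qed

text \<open>
  If two parent maps with the same edges differ at \<open>x\<close>, they also differ at the second parent
  of \<open>x\<close>, which is closer to the root for the second map: infinite descent.
\<close>

lemma inj_on_parent_edges: "inj_on (parent_edges V r) (parent_maps V G r)"
proof (rule inj_onI)
  fix p q
  assume p: "p \<in> parent_maps V G r" and q: "q \<in> parent_maps V G r"
    and eq: "parent_edges V r p = parent_edges V r q"
  obtain d :: "'a \<Rightarrow> nat" where d: "d r = 0" "\<And>x. x \<in> V - {r} \<Longrightarrow> d x = Suc (d (q x))"
    by (rule parent_maps_depth[OF q]) blast
  have "p x = q x" if "x \<in> V - {r}" for x
    using that
  proof (induction "d x" arbitrary: x rule: less_induct)
    case less
    show ?case
    proof (rule ccontr)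
      assume ne: "p x \<noteq> q x"
      have "{x, q x} \<in> parent_edges V r p"
        using less.prems by (auto simp: eq parent_edges_iff)
      then have y: "q x \<in> V - {r}" "p (q x) = x"
        using ne by (auto simp: parent_edges_iff)
      then have "p (q x) = q (q x)"
        using less.hyps[of "q x"] d(2)[OF less.prems] by simp
      \<comment> \<open>Now \<open>x\<close> is its own second parent under \<open>q\<close>, so its
        depth would exceed itself by 2.\<close>
      then show False
        using d(2)[OF less.prems] d(2)[OF y(1)] y(2) by simp
    qed
  qed
  then show "p = q"
    using p q by (intro extensionalityI[of _ "V - {r}"]) (auto simp: parent_maps_def)
qed

section \<open>Recovering a parent map from a spanning tree\<close>

lemma rtrancl_distinct_path:
  assumes "(u, v) \<in> R\<^sup>*"
  obtains xs where "xs \<noteq> []" "hd xs = u" "last xs = v" "distinct xs"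
    "\<And>i. Suc i < length xs \<Longrightarrow> (xs ! i, xs ! Suc i) \<in> R"
proof -
  have "\<exists>xs. xs \<noteq> [] \<and> hd xs = u \<and> last xs = v \<and> distinct xs \<and>
    (\<forall>i. Suc i < length xs \<longrightarrow> (xs ! i, xs ! Suc i) \<in> R)"
    using assms
  proof induction
    case base
    show ?case by (rule exI[of _ "[u]"]) simp
  next
    case (step y z)
    then obtain xs where xs: "xs \<noteq> []" "hd xs = u" "last xs = y" "distinct xs"
      "\<And>i. Suc i < length xs \<Longrightarrow> (xs ! i, xs ! Suc i) \<in> R" by blast
    show ?case
    proof (cases "z \<in> set xs")
      case True
      then obtain i where i: "i < length xs" "xs ! i = z" by (auto simp: in_set_conv_nth)
      \<comment> \<open>If the new vertex already lies on the path, the path is cut back to that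
        vertex instead of being extended.\<close>
      have "last (take (Suc i) xs) = z"
        using i by (simp add: take_Suc_conv_app_nth)
      then show ?thesis
        using xs i by (intro exI[of _ "take (Suc i) xs"]) auto
    next
      case False
      have "((xs @ [z]) ! i, (xs @ [z]) ! Suc i) \<in> R" if "Suc i < length (xs @ [z])" for i
      proof (cases "Suc i < length xs")
        case True
        then show ?thesis using xs(5) by (simp add: nth_append)
      next
        case False
        then have "Suc i = length xs" using that by simp
        moreover from this have "xs ! i = y"
          using xs(1,3) by (metis diff_Suc_1 last_conv_nth)
        ultimately show ?thesis using step.hyps(2) by (simp add: nth_append)
      qed
      then show ?thesis
        using xs False by (intro exI[of _ "xs @ [z]"]) auto
    qed
  qed
  then show ?thesis using that by blast
qed

text \<open>An edge of \<open>T\<close> missing from \<open>S\<close> would close a path in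
  \<open>S\<close> between its ends to a cycle in \<open>T\<close>.\<close>

lemma connected_subgraph_of_tree_eq:
  assumes "is_tree V T" and "connected_graph V S" and "S \<subseteq> T"
  shows "S = T"
proof (rule ccontr)
  assume "S \<noteq> T"
  then obtain e where "e \<in> T" "e \<notin> S" using assms(3) by blast
  moreover from this obtain u v where uv: "u \<in> V" "v \<in> V" "u \<noteq> v" "e = {u, v}"
    using assms(1) by (auto simp: is_tree_def simple_graph_def)
  ultimately have e: "{u, v} \<in> T" "{u, v} \<notin> S" by auto
  have "(u, v) \<in> {(x, y). {x, y} \<in> S}\<^sup>*"
    using assms(2) uv by (auto simp: connected_graph_def)
  then obtain c where c: "c \<noteq> []" "hd c = u" "last c = v" "distinct c"
    "\<And>i. Suc i < length c \<Longrightarrow> (c ! i, c ! Suc i) \<in> {(x, y). {x, y} \<in> S}"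
    by (rule rtrancl_distinct_path) blast
  have ends: "c ! 0 = u" "c ! (length c - 1) = v"
    using c(1-3) by (auto simp: hd_conv_nth last_conv_nth)
  \<comment> \<open>Length 1 would make the ends equal; length 2 would put the missing edge into
    \<open>S\<close>.\<close>
  have "length c \<noteq> 0" using c(1) by simp
  moreover have "length c \<noteq> 1" using ends uv(3) by auto
  moreover have "length c \<noteq> 2" using ends e(2) c(5)[of 0] by auto
  ultimately have len: "3 \<le> length c" by linarith
  have "{c ! i, c ! (Suc i mod length c)} \<in> T" if "i < length c" for i
  proof (cases "Suc i < length c")
    case True
    then show ?thesis using c(5) assms(3) by auto
  next
    case False
    then have "Suc i = length c" using that by simp
    moreover from this have "c ! i = v" using ends(2) by (metis diff_Suc_1)
    ultimately show ?thesis using ends(1) e(1) by (simp add: insert_commute)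
  qed
  then have "is_cycle T c" using len c(4) by (simp add: is_cycle_def)
  then show False using assms(1) by (auto simp: is_tree_def)
qed

text \<open>The parent map of a tree sends a vertex to a neighbour at smaller distance from the root.\<close>

lemma spanning_tree_parent_edges:
  assumes "is_spanning_tree V G T" and "r \<in> V"
  shows "T \<in> parent_edges V r ` parent_maps V G r"
proof -
  have T: "is_tree V T" "T \<subseteq> G" using assms(1) by (auto simp: is_spanning_tree_def)
  define R where "R = {(x, y). {x, y} \<in> T}"
  \<comment> \<open>The distance to the root in \<open>T\<close>; the second vertex of a shortest
    walk to \<open>r\<close> is the neighbour sought.\<close>
  define d where "d x = (LEAST k. (x, r) \<in> R ^^ k)" for x
  have ex: "\<exists>y. (x, y) \<in> R \<and> d y < d x" if "x \<in> V - {r}" for x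
  proof -
    have "(x, r) \<in> R\<^sup>*"
      using T(1) assms(2) that by (auto simp: is_tree_def connected_graph_def R_def)
    then obtain k where "(x, r) \<in> R ^^ k" by (auto simp: rtrancl_power)
    then have dx: "(x, r) \<in> R ^^ d x" unfolding d_def by (rule LeastI)
    then have "d x \<noteq> 0" using that by (intro notI) simp
    then obtain l where l: "d x = Suc l" by (cases "d x") auto
    then obtain y where "(x, y) \<in> R" and y: "(y, r) \<in> R ^^ l"
      using dx by (metis relpow_Suc_D2)
    moreover have "d y \<le> l" unfolding d_def using y by (rule Least_le)
    ultimately show ?thesis using l by auto
  qed
  define p where "p = restrict (\<lambda>x. SOME y. (x, y) \<in> R \<and> d y < d x) (V - {r})"
  have p: "(x, p x) \<in> R" "d (p x) < d x" if "x \<in> V - {r}" for x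
    using someI_ex[OF ex[OF that]] that by (auto simp: p_def)
  have pT: "{x, p x} \<in> T" if "x \<in> V - {r}" for x
    using p(1)[OF that] by (simp add: R_def)
  have pV: "p x \<in> V" if "x \<in> V - {r}" for x
    using pT[OF that] T(1) unfolding is_tree_def simple_graph_def by (auto simp: doubleton_eq_iff)
  have reach: "reach p {r} x" if "x \<in> V" for x
    using that
  proof (induction "d x" arbitrary: x rule: less_induct)
    case less
    show ?case
    proof (cases "x = r")
      case False
      then have "x \<in> V - {r}" using less.prems by blast
      then show ?thesis using less.hyps p(2) pV by (blast intro: reach.step)
    qed (simp add: reach.base)
  qed
  \<comment> \<open>The parent edges already connect \<open>V\<close>, so minimality of the tree
    forces them to be all of \<open>T\<close>.\<close>
  have "connected_graph V (parent_edges V r p)"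
    using assms(2) pV reach by (intro connected_parent_edges) auto
  moreover have "parent_edges V r p \<subseteq> T"
    using pT by (auto simp: parent_edges_def)
  ultimately have "parent_edges V r p = T"
    by (rule connected_subgraph_of_tree_eq[OF T(1)])
  moreover have "p \<in> parent_maps V G r"
    using pV pT T(2) reach by (auto simp: parent_maps_def p_def)
  ultimately show ?thesis by blast
qed

lemma bij_betw_parent_edges:
  assumes "simple_graph V G" and "r \<in> V"
  shows "bij_betw (parent_edges V r) (parent_maps V G r) {T. is_spanning_tree V G T}"
proof (rule bij_betw_imageI[OF inj_on_parent_edges])
  show "parent_edges V r ` parent_maps V G r = {T. is_spanning_tree V G T}"
    using parent_edges_spanning_tree[OF assms] spanning_tree_parent_edges[OF _ assms(2)]
    by (intro equalityI subsetI) auto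
qed

section \<open>Counting bipartite forests level by level\<close>

text \<open>
  Forests on \<open>I \<union> P \<union> Q\<close> with root set \<open>I\<close> whose edges join \<open>P\<close> to \<open>I \<union> Q\<close>, given by their
  parent maps.
\<close>

definition bipartite_forests :: "'a set \<Rightarrow> 'a set \<Rightarrow> 'a set \<Rightarrow> ('a \<Rightarrow> 'a) set" where
  "bipartite_forests I P Q = {p \<in> extensional (P \<union> Q).
     p ` P \<subseteq> I \<union> Q \<and> p ` Q \<subseteq> P \<and> (\<forall>x\<in>P \<union> Q. reach p I x)}"

lemma finite_bipartite_forests:
  assumes "finite I" "finite P" "finite Q"
  shows "finite (bipartite_forests I P Q)"
proof (rule finite_subset)
  show "bipartite_forests I P Q \<subseteq> (P \<union> Q) \<rightarrow>\<^sub>E (I \<union> P \<union> Q)"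
  proof
    fix p
    assume "p \<in> bipartite_forests I P Q"
    then have "p \<in> extensional (P \<union> Q)" "p ` P \<subseteq> I \<union> Q" "p ` Q \<subseteq> P"
      by (simp_all add: bipartite_forests_def)
    then show "p \<in> (P \<union> Q) \<rightarrow>\<^sub>E (I \<union> P \<union> Q)"
      unfolding PiE_iff by blast
  qed
  show "finite ((P \<union> Q) \<rightarrow>\<^sub>E (I \<union> P \<union> Q))"
    using assms by (intro finite_PiE) auto
qed

lemma bipartite_forests_no_roots:
  "bipartite_forests {} P Q = (if P \<union> Q = {} then {\<lambda>_. undefined} else {})"
  by (auto simp: bipartite_forests_def not_reach_empty)

text \<open>Since \<open>Q\<close> is mapped into \<open>P\<close>, an orbit can enter
  \<open>I\<close> only from a vertex of \<open>P\<close> whose parent is a root.\<close>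

lemma reach_level:
  assumes "p ` P \<subseteq> I \<union> Q" and "p ` Q \<subseteq> P" and "I \<inter> (P \<union> Q) = {}" and "x \<in> P \<union> Q"
  shows "reach p I x \<longleftrightarrow> reach p {x \<in> P. p x \<in> I} x"
proof
  assume "reach p I x"
  then show "reach p {x \<in> P. p x \<in> I} x"
    using assms(4)
  proof induction
    case (base x)
    then show ?case using assms(3) by blast
  next
    case (step x)
    show ?case
    proof (cases "p x \<in> I")
      case True
      then show ?thesis using step.prems assms(2,3) by (intro reach.base) auto
    next
      case False
      then have "p x \<in> P \<union> Q" using step.prems assms(1,2) by blast
      then show ?thesis using step.IH by (blast intro: reach.step)
    qed
  qed
next
  assume "reach p {x \<in> P. p x \<in> I} x"
  then show "reach p I x"
    by induction (auto intro: reach.intros)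
qed

text \<open>Once \<open>J\<close> is fixed, its elements choose their parents in \<open>I\<close>
  freely. The rest maps \<open>P - J\<close> into \<open>Q\<close> and \<open>Q\<close> into
  \<open>J\<close> or \<open>P - J\<close>, hence is a forest rooted at \<open>J\<close> with the
  sides exchanged. The inverse glues the two maps.\<close>

lemma bij_betw_level:
  assumes disj: "I \<inter> (P \<union> Q) = {}" "P \<inter> Q = {}" and "J \<subseteq> P"
  shows "bij_betw (\<lambda>p. (restrict p J, restrict p (Q \<union> (P - J))))
    {p \<in> bipartite_forests I P Q. {x \<in> P. p x \<in> I} = J}
    ((J \<rightarrow>\<^sub>E I) \<times> bipartite_forests J Q (P - J))"
proof (rule bij_betw_byWitness[where f' = "\<lambda>(f, g) x. if x \<in> J then f x else g x"])
  let ?D = "Q \<union> (P - J)"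
  have JD: "J \<inter> ?D = {}" using assms by blast
  show "\<forall>p\<in>{p \<in> bipartite_forests I P Q. {x \<in> P. p x \<in> I} = J}.
    (\<lambda>(f, g) x. if x \<in> J then f x else g x) (restrict p J, restrict p ?D) = p"
    using assms(3) by (auto simp: bipartite_forests_def extensional_def fun_eq_iff)
  show "\<forall>fg\<in>(J \<rightarrow>\<^sub>E I) \<times> bipartite_forests J Q (P - J).
    (restrict ((\<lambda>(f, g) x. if x \<in> J then f x else g x) fg) J,
     restrict ((\<lambda>(f, g) x. if x \<in> J then f x else g x) fg) ?D) = fg"
    using JD by (fastforce simp: bipartite_forests_def extensional_def fun_eq_iff PiE_iff)
  show "(\<lambda>p. (restrict p J, restrict p ?D)) `
    {p \<in> bipartite_forests I P Q. {x \<in> P. p x \<in> I} = J}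
    \<subseteq> (J \<rightarrow>\<^sub>E I) \<times> bipartite_forests J Q (P - J)"
  proof (clarify, intro conjI SigmaI)
    fix p
    assume p: "p \<in> bipartite_forests I P Q" and J: "J = {x \<in> P. p x \<in> I}"
    have pPQ: "p ` P \<subseteq> I \<union> Q" "p ` Q \<subseteq> P" and r: "\<And>x. x \<in> P \<union> Q \<Longrightarrow> reach p I x"
      using p by (auto simp: bipartite_forests_def)
    show "restrict p {x \<in> P. p x \<in> I} \<in> {x \<in> P. p x \<in> I} \<rightarrow>\<^sub>E I" by auto
    have "reach (restrict p ?D) J x" if "x \<in> ?D" for x
    proof (rule reach_cong[where D = ?D])
      show "reach p J x"
        using reach_level[OF pPQ disj(1), of x] r that unfolding J by auto
    qed (use that pPQ in \<open>auto simp: J\<close>)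
    then show "restrict p (Q \<union> (P - {x \<in> P. p x \<in> I})) \<in>
        bipartite_forests {x \<in> P. p x \<in> I} Q (P - {x \<in> P. p x \<in> I})"
      using pPQ disj unfolding J by (auto simp: bipartite_forests_def)
  qed
  show "(\<lambda>(f, g) x. if x \<in> J then f x else g x) ` ((J \<rightarrow>\<^sub>E I) \<times> bipartite_forests J Q (P - J))
    \<subseteq> {p \<in> bipartite_forests I P Q. {x \<in> P. p x \<in> I} = J}"
  proof clarify
    fix f g
    assume f: "f \<in> J \<rightarrow>\<^sub>E I" and g: "g \<in> bipartite_forests J Q (P - J)"
    define p where "p = (\<lambda>x. if x \<in> J then f x else g x)"
    have gPQ: "g ` Q \<subseteq> P" "g ` (P - J) \<subseteq> Q" and gext: "g \<in> extensional ?D"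
      and r: "\<And>x. x \<in> ?D \<Longrightarrow> reach g J x"
      using g assms(3) by (auto simp: bipartite_forests_def)
    have pPQ: "p ` P \<subseteq> I \<union> Q" "p ` Q \<subseteq> P"
      using gPQ f JD assms(3) by (auto simp: p_def PiE_iff)
    have J: "{x \<in> P. p x \<in> I} = J"
      using f gPQ disj assms(3) by (auto simp: p_def PiE_iff)
    have "reach p I x" if x: "x \<in> P \<union> Q" for x
    proof -
      have "reach p J x"
      proof (cases "x \<in> J")
        case False
        show ?thesis
        proof (rule reach_cong[where D = ?D and p = g])
          show "reach g J x" using r x False by blast
        qed (use JD x gPQ in \<open>auto simp: p_def\<close>)
      qed (rule reach.base)
      then show ?thesis using reach_level[OF pPQ disj(1) x] J by simp
    qed
    moreover have "p \<in> extensional (P \<union> Q)"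
      using gext assms(3) by (auto simp: p_def extensional_def)
    ultimately have "p \<in> bipartite_forests I P Q"
      using pPQ by (simp add: bipartite_forests_def)
    then show "(\<lambda>x. if x \<in> J then f x else g x) \<in> bipartite_forests I P Q \<and>
        {x \<in> P. (if x \<in> J then f x else g x) \<in> I} = J"
      using J unfolding p_def by blast
  qed
qed

lemma card_level:
  assumes "I \<inter> (P \<union> Q) = {}" "P \<inter> Q = {}" "J \<subseteq> P" "finite P"
  shows "card {p \<in> bipartite_forests I P Q. {x \<in> P. p x \<in> I} = J} =
    card I ^ card J * card (bipartite_forests J Q (P - J))"
  using bij_betw_same_card[OF bij_betw_level[OF assms(1-3)]]
    finite_subset[OF assms(3,4)] by (simp add: card_cartesian_product card_funcsetE)

lemma card_bipartite_forests_rec: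
  assumes "finite I" "finite P" "finite Q" "I \<inter> (P \<union> Q) = {}" "P \<inter> Q = {}"
  shows "card (bipartite_forests I P Q) =
    (\<Sum>J\<in>Pow P. card I ^ card J * card (bipartite_forests J Q (P - J)))"
proof -
  have "card (bipartite_forests I P Q) =
    (\<Sum>J\<in>Pow P. card {p \<in> bipartite_forests I P Q. {x \<in> P. p x \<in> I} = J})"
    unfolding card_eq_sum
    using assms(2) finite_bipartite_forests[OF assms(1-3)]
    by (intro sum.group[symmetric]) auto
  then show ?thesis
    using assms by (simp add: card_level)
qed

section \<open>Binomial sums and the closed form\<close>

lemma sum_Pow_card:
  fixes f :: "nat \<Rightarrow> 'b::semiring_1"
  assumes "finite A"
  shows "(\<Sum>J\<in>Pow A. f (card J)) = (\<Sum>j\<le>card A. of_nat (card A choose j) * f j)"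
proof -
  have "(\<Sum>J\<in>Pow A. f (card J)) = (\<Sum>j\<le>card A. \<Sum>J\<in>{J \<in> Pow A. card J = j}. f (card J))"
    using assms by (intro sum.group[symmetric]) (auto intro: card_mono)
  also have "\<dots> = (\<Sum>j\<le>card A. of_nat (card A choose j) * f j)"
    using assms by (intro sum.cong refl) (simp add: n_subsets)
  finally show ?thesis .
qed

text \<open>Absorbing the factor \<open>j\<close> into the binomial coefficient lowers both of its
  arguments by one; the binomial theorem then applies.\<close>

lemma sum_index_binomial:
  fixes x y :: "'b::comm_semiring_1"
  shows "(\<Sum>j\<le>n. of_nat (n choose j) * (of_nat j * x ^ j * y ^ (n - j))) =
    of_nat n * x * (x + y) ^ (n - 1)"
proof (cases n)
  case (Suc l)
  have "(\<Sum>j\<le>n. of_nat (n choose j) * (of_nat j * x ^ j * y ^ (n - j))) =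
    (\<Sum>j\<le>l. of_nat (Suc j * (Suc l choose Suc j)) * x ^ Suc j * y ^ (l - j))"
    unfolding Suc sum.atMost_Suc_shift
    by (simp add: ac_simps del: binomial_Suc_Suc of_nat_Suc power_Suc mult_Suc)
  also have "\<dots> = of_nat n * x * (\<Sum>j\<le>l. of_nat (l choose j) * x ^ j * y ^ (l - j))"
    unfolding Suc_times_binomial by (simp add: Suc sum_distrib_left ac_simps del: of_nat_Suc mult_Suc)
  finally show ?thesis by (simp add: Suc binomial_ring)
qed simp

text \<open>
  The closed form is multiplied by \<open>card I + card Q\<close> so that it also holds for empty \<open>P\<close>, where
  the exponent \<open>card P - 1\<close> is truncated.
\<close>

lemma card_bipartite_forests:
  assumes "finite I" "finite P" "finite Q" "I \<inter> (P \<union> Q) = {}" "P \<inter> Q = {}"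
  shows "card (bipartite_forests I P Q) * (card I + card Q) =
    card I * (card I + card Q) ^ card P * card P ^ card Q"
  using assms
proof (induction "card P + card Q" arbitrary: I P Q rule: less_induct)
  case less
  show ?case
  proof (cases "P = {}")
    case True
    \<comment> \<open>Without \<open>P\<close> a forest exists only if \<open>Q\<close> is empty;
      this agrees with \<open>0 ^ card Q\<close>, where \<open>0 ^ 0 = 1\<close>.\<close>
    have "card (bipartite_forests I P Q) = (if Q = {} then 1 else 0)"
      using less.prems by (subst card_bipartite_forests_rec) (simp_all add: True bipartite_forests_no_roots)
    then show ?thesis using True less.prems by (auto simp: card_gt_0_iff)
  next
    case False
    let ?i = "card I" and ?p = "card P" and ?q = "card Q"
    have p: "?p > 0" using False less.prems by (simp add: card_gt_0_iff)
    have level: "card (bipartite_forests J Q (P - J)) * ?p = card J * ?p ^ ?q * ?q ^ (?p - card J)"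
      if J: "J \<subseteq> P" for J
    \<comment> \<open>Empty \<open>J\<close> does not decrease the induction measure, but both sides
      vanish as \<open>P\<close> is nonempty. Otherwise the induction hypothesis applies, with
      \<open>card J + card (P - J) = card P\<close>.\<close>
    proof (cases "J = {}")
      case True
      then show ?thesis using False by (simp add: bipartite_forests_no_roots)
    next
      case False
      have fin: "finite J" using J less.prems(2) by (rule finite_subset)
      then have c: "card (P - J) = ?p - card J" "card J > 0" "card J \<le> ?p"
        using J False less.prems by (auto simp: card_Diff_subset card_gt_0_iff card_mono)
      have "card (bipartite_forests J Q (P - J)) * (card J + card (P - J)) =
        card J * (card J + card (P - J)) ^ card Q * card Q ^ card (P - J)"
        using J fin c less.prems by (intro less.hyps) auto
      then show ?thesis using c by simp
    qed
    have "card (bipartite_forests I P Q) * ?p =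
      (\<Sum>J\<in>Pow P. ?i ^ card J * (card (bipartite_forests J Q (P - J)) * ?p))"
      using less.prems by (subst card_bipartite_forests_rec) (simp_all add: sum_distrib_left ac_simps)
    also have "\<dots> = (\<Sum>J\<in>Pow P. ?i ^ card J * (card J * ?p ^ ?q * ?q ^ (?p - card J)))"
      by (intro sum.cong refl) (simp add: level)
    also have "\<dots> = ?p ^ ?q * (\<Sum>J\<in>Pow P. card J * ?i ^ card J * ?q ^ (?p - card J))"
      by (simp add: sum_distrib_left ac_simps)
    also have "\<dots> = ?p ^ ?q * (?p * ?i * (?i + ?q) ^ (?p - 1))"
      using sum_Pow_card[OF less.prems(2), of "\<lambda>j. j * ?i ^ j * ?q ^ (?p - j)"]
        sum_index_binomial[of ?p ?i ?q] by simp
    finally have "card (bipartite_forests I P Q) = ?p ^ ?q * ?i * (?i + ?q) ^ (?p - 1)"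
      using p by simp
    moreover have "(?i + ?q) ^ ?p = (?i + ?q) ^ (?p - 1) * (?i + ?q)"
      using p by (simp add: power_eq_if)
    ultimately show ?thesis by simp
  qed
qed

section \<open>Uprooted spanning trees of the complete bipartite graph\<close>

lemma Kmn_edges_iff:
  "{x, y} \<in> Kmn_edges m n \<longleftrightarrow>
    x \<in> {1..m} \<and> y \<in> {m+1..m+n} \<or> y \<in> {1..m} \<and> x \<in> {m+1..m+n}"
  unfolding Kmn_edges_def mem_Collect_eq doubleton_eq_iff by blast

lemma simple_graph_Kmn: "simple_graph (Kmn_verts m n) (Kmn_edges m n)"
proof -
  have "\<exists>u\<in>Kmn_verts m n. \<exists>v\<in>Kmn_verts m n. u \<noteq> v \<and> e = {u, v}" if e: "e \<in> Kmn_edges m n" for e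
  proof -
    obtain u v where "u \<in> {1..m}" "v \<in> {m + 1..m + n}" "e = {u, v}"
      using e unfolding Kmn_edges_def by blast
    then show ?thesis by (intro bexI[of _ u] bexI[of _ v]) (auto simp: Kmn_verts_def)
  qed
  then show ?thesis by (auto simp: simple_graph_def Kmn_verts_def)
qed

text \<open>The root belongs to the second part of the graph, which leaves \<open>n - 1\<close>
  vertices for \<open>Q\<close>.\<close>

lemma parent_maps_Kmn:
  assumes "1 \<le> n"
  shows "parent_maps (Kmn_verts m n) (Kmn_edges m n) (m + n) =
    bipartite_forests {m + n} {1..m} {m + 1..<m + n}"
proof -
  let ?D = "{1..m} \<union> {m + 1..<m + n}"
  have V: "Kmn_verts m n - {m + n} = ?D"
    using assms by (auto simp: Kmn_verts_def)
  have edge: "y \<in> Kmn_verts m n \<and> {x, y} \<in> Kmn_edges m n \<longleftrightarrow>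
      (x \<in> {1..m} \<longrightarrow> y \<in> {m + n} \<union> {m + 1..<m + n}) \<and> (x \<in> {m + 1..<m + n} \<longrightarrow> y \<in> {1..m})"
    if "x \<in> ?D" for x y
    using that assms by (auto simp: Kmn_verts_def Kmn_edges_iff)
  have "(\<forall>x\<in>?D. p x \<in> Kmn_verts m n \<and> {x, p x} \<in> Kmn_edges m n \<and> reach p {m + n} x) \<longleftrightarrow>
      p ` {1..m} \<subseteq> {m + n} \<union> {m + 1..<m + n} \<and> p ` {m + 1..<m + n} \<subseteq> {1..m} \<and>
      (\<forall>x\<in>?D. reach p {m + n} x)" for p
  proof -
    have "(\<forall>x\<in>?D. p x \<in> Kmn_verts m n \<and> {x, p x} \<in> Kmn_edges m n) \<longleftrightarrow>
      (\<forall>x\<in>?D. (x \<in> {1..m} \<longrightarrow> p x \<in> {m + n} \<union> {m + 1..<m + n}) \<and>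
        (x \<in> {m + 1..<m + n} \<longrightarrow> p x \<in> {1..m}))"
      by (intro ball_cong refl edge)
    also have "\<dots> \<longleftrightarrow>
      p ` {1..m} \<subseteq> {m + n} \<union> {m + 1..<m + n} \<and> p ` {m + 1..<m + n} \<subseteq> {1..m}"
      by blast
    finally show ?thesis by (simp only: ball_conj_distrib conj_assoc[symmetric])
  qed
  then show ?thesis
    unfolding parent_maps_def bipartite_forests_def V by (simp only:)
qed

lemma uprooted_spanning_trees_eq_image:
  assumes "1 \<le> n"
  shows "uprooted_spanning_trees m n k = parent_edges (Kmn_verts m n) (m + n) `
    {p \<in> bipartite_forests {m + n} {1..m} {m + 1..<m + n}.
      Max {x \<in> {1..m}. p x \<in> {m + n}} = m + 1 - k}"
proof -
  let ?V = "Kmn_verts m n" and ?r = "m + n"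
  let ?F = "bipartite_forests {m + n} {1..m} {m + 1..<m + n}"
  have r: "?r \<in> ?V" using assms by (simp add: Kmn_verts_def)
  have trees: "{T. is_spanning_tree ?V (Kmn_edges m n) T} = parent_edges ?V ?r ` ?F"
    using bij_betw_parent_edges[OF simple_graph_Kmn r]
    unfolding parent_maps_Kmn[OF assms] by (simp add: bij_betw_def)
  have "uprooted_tree ?V T ?r" if T: "is_spanning_tree ?V (Kmn_edges m n) T" for T
  proof -
    have "c < ?r" if "{c, ?r} \<in> Kmn_edges m n" for c
      using that assms by (auto simp: Kmn_edges_iff)
    then show ?thesis
      using T r by (auto simp: uprooted_tree_def rooted_tree_def is_spanning_tree_def
        root_children_def neighbours_def)
  qed
  then have "uprooted_spanning_trees m n k =
    {T \<in> parent_edges ?V ?r ` ?F. Max (root_children T ?r) = m + 1 - k}"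
    unfolding trees[symmetric] uprooted_spanning_trees_def by blast
  moreover have "root_children (parent_edges ?V ?r p) ?r = {x \<in> {1..m}. p x \<in> {?r}}"
    if "p \<in> ?F" for p
  proof -
    \<comment> \<open>Only vertices of \<open>{1..m}\<close> can have the root as parent, and the
      root has no parent edge of its own.\<close>
    have "p ` {m + 1..<m + n} \<subseteq> {1..m}" using that by (simp add: bipartite_forests_def)
    then have "p x \<noteq> ?r" if "x \<in> {m + 1..<m + n}" for x
      using that assms by fastforce
    then show ?thesis
      using assms by (fastforce simp: root_children_def neighbours_def parent_edges_iff Kmn_verts_def)
  qed
  ultimately show ?thesis by auto
qed

section \<open>Summing over the sets of children of the root\<close>

lemma nonempty_subsets_with_Max:
  fixes a m :: nat
  assumes "Suc a \<le> m"
  shows "{J \<in> Pow {1..m}. J \<noteq> {} \<and> Max J = Suc a} = insert (Suc a) ` Pow {1..a}"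
proof (intro equalityI subsetI)
  fix J
  assume "J \<in> {J \<in> Pow {1..m}. J \<noteq> {} \<and> Max J = Suc a}"
  then have J: "J \<subseteq> {1..m}" "J \<noteq> {}" "Max J = Suc a" by auto
  have fin: "finite J" using J(1) by (rule finite_subset) simp
  have "Suc a \<in> J" using Max_in[OF fin J(2)] J(3) by simp
  moreover have "x \<in> {1..a}" if "x \<in> J" "x \<noteq> Suc a" for x
    using Max_ge[OF fin that(1)] J(1,3) that by auto
  ultimately have "J = insert (Suc a) (J - {Suc a})" "J - {Suc a} \<in> Pow {1..a}" by blast+
  then show "J \<in> insert (Suc a) ` Pow {1..a}" by blast
next
  fix J
  assume "J \<in> insert (Suc a) ` Pow {1..a}"
  then obtain K where K: "K \<subseteq> {1..a}" "J = insert (Suc a) K" by blast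
  then have "finite J" using finite_subset by auto
  then have "Max J = Suc a" using K by (intro Max_eqI) auto
  then show "J \<in> {J \<in> Pow {1..m}. J \<noteq> {} \<and> Max J = Suc a}" using K assms by auto
qed

text \<open>The factor \<open>m * n\<close> keeps the identity within the natural numbers, since the
  exponents \<open>n - 2\<close> and \<open>m - k - 1\<close> of the final formula can be
  -1.\<close>

lemma card_uprooted_spanning_trees:
  assumes "1 \<le> n" and "1 \<le> k" and "k \<le> m"
  shows "card (uprooted_spanning_trees m n k) * (m * n) =
    m ^ (n - 1) * (n - 1) ^ (k - 1) * n ^ (m - k) * (m - k + n)"
proof -
  let ?V = "Kmn_verts m n" and ?r = "m + n"
  let ?B = "{m + 1..<m + n}" and ?N = "n - 1" and ?a = "m - k"
  let ?F = "bipartite_forests {?r} {1..m} ?B"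
  let ?J = "\<lambda>p. {x \<in> {1..m}. p x \<in> {?r}}"
  let ?S = "{J \<in> Pow {1..m}. J \<noteq> {} \<and> Max J = Suc ?a}"
  \<comment> \<open>\<open>m\<close> times the number of forests below \<open>j\<close> children of
    the root: in the closed form, \<open>card I + card Q\<close> is
    \<open>j + (m - j) = m\<close>.\<close>
  let ?w = "\<lambda>j. j * m ^ ?N * ?N ^ (m - j)"
  have k: "m + 1 - k = Suc ?a" "Suc ?a \<le> m" using assms by auto
  have finF: "finite ?F" by (intro finite_bipartite_forests) auto
  have level: "card {p \<in> ?F. ?J p = J} = card (bipartite_forests J ?B ({1..m} - J))"
    if "J \<subseteq> {1..m}" for J
    using that assms by (subst card_level) auto
  \<comment> \<open>\<open>Max {}\<close> is unspecified, so a root without children must be ruled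
    out before sorting by \<open>Max\<close>.\<close>
  have nonempty: "?J p \<noteq> {}" if "p \<in> ?F" for p
  proof
    assume "?J p = {}"
    then have "p \<in> {p \<in> ?F. ?J p = {}}" using that by blast
    moreover have "card {p \<in> ?F. ?J p = {}} = 0"
      using level[of "{}"] assms by (simp add: bipartite_forests_no_roots)
    ultimately show False using finF by auto
  qed
  have "inj_on (parent_edges ?V ?r) ?F"
    using inj_on_parent_edges parent_maps_Kmn[OF assms(1)] by metis
  then have "card (uprooted_spanning_trees m n k) = card {p \<in> ?F. Max (?J p) = Suc ?a}"
    unfolding uprooted_spanning_trees_eq_image[OF assms(1)] k(1)
    by (intro card_image) (auto intro: inj_on_subset)
  also have "\<dots> = (\<Sum>J\<in>?S. card {p \<in> {p \<in> ?F. Max (?J p) = Suc ?a}. ?J p = J})"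
    unfolding card_eq_sum
    using finF nonempty by (intro sum.group[symmetric]) auto
  also have "\<dots> = (\<Sum>J\<in>?S. card {p \<in> ?F. ?J p = J})"
    by (intro sum.cong refl arg_cong[where f = card]) auto
  also have "\<dots> = (\<Sum>J\<in>?S. card (bipartite_forests J ?B ({1..m} - J)))"
    by (intro sum.cong refl level) auto
  finally have "card (uprooted_spanning_trees m n k) * m =
      (\<Sum>J\<in>?S. card (bipartite_forests J ?B ({1..m} - J)) * m)"
    by (simp add: sum_distrib_right)
  also have "\<dots> = (\<Sum>J\<in>?S. ?w (card J))"
  proof (intro sum.cong refl)
    fix J
    assume "J \<in> ?S"
    then have J: "J \<subseteq> {1..m}" by blast
    then have fin: "finite J" by (rule finite_subset) simp
    have "card J \<le> m" using card_mono[OF _ J] by simp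
    then have c: "card ({1..m} - J) = m - card J" "card J + (m - card J) = m"
      using J fin by (auto simp: card_Diff_subset)
    have "card (bipartite_forests J ?B ({1..m} - J)) * (card J + card ({1..m} - J)) =
      card J * (card J + card ({1..m} - J)) ^ card ?B * card ?B ^ card ({1..m} - J)"
      using J fin by (intro card_bipartite_forests) auto
    then show "card (bipartite_forests J ?B ({1..m} - J)) * m = ?w (card J)"
      unfolding c by simp
  qed
  also have "\<dots> = (\<Sum>K\<in>Pow {1..?a}. ?w (card (insert (Suc ?a) K)))"
    unfolding nonempty_subsets_with_Max[OF k(2)]
  proof (intro sum.reindex[unfolded o_def] inj_onI)
    fix K L
    assume "K \<in> Pow {1..?a}" "L \<in> Pow {1..?a}" "insert (Suc ?a) K = insert (Suc ?a) L"
    moreover from this have "Suc ?a \<notin> K" "Suc ?a \<notin> L" by auto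
    ultimately show "K = L" by (simp add: insert_ident)
  qed
  also have "\<dots> = (\<Sum>K\<in>Pow {1..?a}. ?w (Suc (card K)))"
  proof (intro sum.cong refl)
    fix K
    assume "K \<in> Pow {1..?a}"
    then have "finite K" "Suc ?a \<notin> K" using finite_subset by auto
    then show "?w (card (insert (Suc ?a) K)) = ?w (Suc (card K))" by simp
  qed
  also have "\<dots> = (\<Sum>j\<le>?a. (?a choose j) * ?w (Suc j))"
    using sum_Pow_card[of "{1..?a}" "\<lambda>j. ?w (Suc j)"] by simp
  also have "\<dots> = m ^ ?N * ?N ^ (k - 1) * (\<Sum>j\<le>?a. (?a choose j) * (Suc j * ?N ^ (?a - j)))"
    unfolding sum_distrib_left
  proof (intro sum.cong refl)
    fix j
    assume "j \<in> {..?a}"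
    \<comment> \<open>This splitting of the exponent pulls the constant power of
      \<open>n - 1\<close> out of the sum.\<close>
    then have "m - Suc j = (k - 1) + (?a - j)" using assms by auto
    then show "(?a choose j) * ?w (Suc j) =
        m ^ ?N * ?N ^ (k - 1) * ((?a choose j) * (Suc j * ?N ^ (?a - j)))"
      by (simp only: power_add ac_simps)
  qed
  \<comment> \<open>Splitting \<open>Suc j\<close> as \<open>j + 1\<close> gives an index-weighted
    and a plain binomial sum, both with base \<open>1 + (n - 1) = n\<close>.\<close>
  also have "(\<Sum>j\<le>?a. (?a choose j) * (Suc j * ?N ^ (?a - j))) = ?a * n ^ (?a - 1) + n ^ ?a"
    using sum_index_binomial[of ?a 1 ?N] binomial[of 1 ?N ?a] assms(1)
    by (simp add: sum.distrib algebra_simps)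
  finally have "card (uprooted_spanning_trees m n k) * (m * n) =
      m ^ ?N * ?N ^ (k - 1) * ((?a * n ^ (?a - 1) + n ^ ?a) * n)"
    by (simp add: ac_simps)
  also have "(?a * n ^ (?a - 1) + n ^ ?a) * n = n ^ ?a * (?a + n)"
    \<comment> \<open>For \<open>k = m\<close> the exponent \<open>?a - 1\<close> is truncated, but
      its coefficient \<open>?a\<close> is zero.\<close>
    by (cases ?a) (simp_all add: algebra_simps)
  finally show ?thesis by (simp add: ac_simps)
qed

theorem theorem3p1:
  fixes m n k :: nat
  assumes "1 \<le> m" and "1 \<le> n" and "1 \<le> k" and "k \<le> m"
  shows "real (card (uprooted_spanning_trees m n k)) =
    real m powi (int n - 2) * real n powi (int m - int k - 1) *
    (real n - 1) ^ (k - 1) * (real m + real n - real k)"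
proof -
  have pos: "real m > 0" "real n > 0" using assms by auto
  have diffs: "real (n - 1) = real n - 1" "real (m - k + n) = real m + real n - real k"
    using assms by auto
  have "real (card (uprooted_spanning_trees m n k) * (m * n)) =
    real (m ^ (n - 1) * (n - 1) ^ (k - 1) * n ^ (m - k) * (m - k + n))"
    using card_uprooted_spanning_trees[OF assms(2-4)] by simp
  then have eq: "real (card (uprooted_spanning_trees m n k)) * (real m * real n) =
    real m ^ (n - 1) * (real n - 1) ^ (k - 1) * real n ^ (m - k) * (real m + real n - real k)"
    using diffs by (simp only: of_nat_mult of_nat_power)
  \<comment> \<open>One factor of the base raises the possibly negative integer exponent to a
    natural one; likewise for \<open>n\<close> below.\<close>
  have m: "real m powi (int n - 2) * real m = real m ^ (n - 1)"
  proof -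
    have "real m powi (int n - 2) * real m = real m powi (int n - 2 + 1)"
      using pos by (subst power_int_add_1) auto
    also have "int n - 2 + 1 = int (n - 1)" using assms by simp
    finally show ?thesis by (simp only: power_int_of_nat)
  qed
  have n: "real n powi (int m - int k - 1) * real n = real n ^ (m - k)"
  proof -
    have "real n powi (int m - int k - 1) * real n = real n powi (int m - int k - 1 + 1)"
      using pos by (subst power_int_add_1) auto
    also have "int m - int k - 1 + 1 = int (m - k)" using assms by simp
    finally show ?thesis by (simp only: power_int_of_nat)
  qed
  have "real (card (uprooted_spanning_trees m n k)) * (real m * real n) =
    (real m powi (int n - 2) * real n powi (int m - int k - 1) *
    (real n - 1) ^ (k - 1) * (real m + real n - real k)) * (real m * real n)"
    using eq unfolding m[symmetric] n[symmetric] by (simp only: ac_simps)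
  then show ?thesis using pos by simp
qed

end
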